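(* Let $\Gamma$ be a lattice in $\mathbb{R}^d\times\mathbb{R}$ in general position, let $I\subset\mathbb{R}$ be a semi-closed interval, $I=[a,b)$ or $I=(a,b]$, with $|I|\in p_2(\Gamma)$, and let $\Lambda=\Lambda(\Gamma,I)=\{p_1(\gamma):\gamma\in\Gamma,\ p_2(\gamma)\in I\}$ be the corresponding simple quasicrystal, with uniform density $\mathcal{D}(\Lambda)=|I|/\det\Gamma$. Let $K$ be a compact set and $U$ be an open set in $\mathbb{R}^d$ such that $K\subset U$ and $\operatorname{mes}K<\mathcal{D}(\Lambda)<\operatorname{mes}U$. Then one can find a Riemann measurable set $S$ such that $K\subset S\subset U$ and (i) $\operatorname{mes}S=\mathcal{D}(\Lambda)$; (ii) $S$ is equidecomposable to a parallelepiped spanned by vectors in $p_1(\Gamma^* )$, using only translations by vectors in $p_1(\Gamma^* )$.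
   Context: A lattice $\Gamma$ in $\mathbb{R}^k$ is the image of $\mathbb{Z}^k$ under an invertible $k\times k$ matrix $A$; $\det\Gamma=|\det A|$. The dual lattice is $\Gamma^*=\{\gamma^*\in\mathbb{R}^k:\langle\gamma,\gamma^*\rangle\in\mathbb{Z}\ \text{for all}\ \gamma\in\Gamma\}$. $p_1$ and $p_2$ denote the projections of $\mathbb{R}^d\times\mathbb{R}$ onto $\mathbb{R}^d$ and $\mathbb{R}$ respectively. The lattice $\Gamma$ is in general position if the restrictions of $p_1$ and $p_2$ to $\Gamma$ are injective and $p_1(\Gamma)$, $p_2(\Gamma)$ are dense in $\mathbb{R}^d$ and $\mathbb{R}$ respectively. Here $a<b$ are real and $|I|=b-a$. $\operatorname{mes}$ is Lebesgue measure. A bounded set in $\mathbb{R}^d$ is Riemann measurable if its boundary has Lebesgue measure zero. Two Riemann measurable sets $S,S'\subset\mathbb{R}^d$ are equidecomposable using translations by vectors in a subgroup $G\subset\mathbb{R}^d$ if $S$ can be partitioned into finitely many Riemann measurable subsets that can be reassembled, using translations by vectors in $G$, to form, up to measure zero, a partition of $S'$. *)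

theory Defs
  imports "HOL-Analysis.Analysis"
begin

text \<open>
  The space \<open>\<real>\<^sup>d \<times> \<real>\<close> is rendered as \<^typ>\<open>real ^ ('d option)\<close>, so that lattices in it are given by
  square matrices: the indices \<open>Some i\<close> are the coordinates of \<open>\<real>\<^sup>d\<close>, and \<open>None\<close> is the last one.
\<close>

definition p1 :: "real ^ ('d::finite option) \<Rightarrow> real ^ 'd" where
  "p1 x = (\<chi> i. x $ Some i)"

definition p2 :: "real ^ ('d::finite option) \<Rightarrow> real" where
  "p2 x = x $ None"

definition matrix_lattice :: "real ^ 'k ^ 'k \<Rightarrow> (real ^ 'k::finite) set" where
  "matrix_lattice A = (\<lambda>z. A *v z) ` {z. \<forall>i. z $ i \<in> \<int>}"

definition is_lattice :: "(real ^ 'k::finite) set \<Rightarrow> bool" where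
  "is_lattice \<Gamma> \<longleftrightarrow> (\<exists>A. invertible A \<and> \<Gamma> = matrix_lattice A)"

text \<open>The choice of the matrix is immaterial, see \<open>lattice_det_matrix_lattice\<close> below.\<close>

definition lattice_det :: "(real ^ 'k::finite) set \<Rightarrow> real" where
  "lattice_det \<Gamma> = \<bar>det (SOME A. invertible A \<and> \<Gamma> = matrix_lattice A)\<bar>"

lemma matrix_lattice_subset_imp_factor:
  fixes A B :: "real ^ 'k::finite ^ 'k"
  assumes "matrix_lattice A \<subseteq> matrix_lattice B"
  obtains U where "A = B ** U" "det U \<in> \<int>"
proof -
  have "\<exists>z. (\<forall>i. z $ i \<in> \<int>) \<and> A *v axis j 1 = B *v z" for j
  proof -
    have "A *v axis j 1 \<in> matrix_lattice A"
      unfolding matrix_lattice_def by (rule imageI) (auto simp: axis_def)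
    then show ?thesis
      using assms unfolding matrix_lattice_def image_iff subset_iff by blast
  qed
  then obtain z where z: "\<And>j i. z j $ i \<in> \<int>" "\<And>j. A *v axis j 1 = B *v z j"
    by metis
  define U :: "real ^ 'k ^ 'k" where "U = (\<chi> i j. z j $ i)"
  have "A $ i $ j = (B ** U) $ i $ j" for i j
  proof -
    have "A $ i $ j = (A *v axis j 1) $ i"
      by (simp add: matrix_vector_mul_component inner_axis)
    also have "\<dots> = (B *v z j) $ i"
      by (simp only: z(2))
    also have "\<dots> = (B ** U) $ i $ j"
      by (simp add: matrix_matrix_mult_def matrix_vector_mult_def U_def)
    finally show ?thesis .
  qed
  then have "A = B ** U"
    by (simp add: vec_eq_iff)
  moreover have "det U \<in> \<int>"
    unfolding det_def U_def by (intro Ints_sum Ints_mult Ints_prod) (auto simp: z(1))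
  ultimately show ?thesis
    using that by blast
qed

lemma matrix_lattice_eq_imp_abs_det_eq:
  fixes A B :: "real ^ 'k::finite ^ 'k"
  assumes "invertible A" "invertible B" "matrix_lattice A = matrix_lattice B"
  shows "\<bar>det A\<bar> = \<bar>det B\<bar>"
proof -
  have le: "\<bar>det B\<bar> \<le> \<bar>det A\<bar>"
    if inv: "invertible A" and eq: "matrix_lattice A = matrix_lattice B" for A B :: "real ^ 'k ^ 'k"
  proof -
    obtain U where U: "A = B ** U" "det U \<in> \<int>"
      using matrix_lattice_subset_imp_factor[of A B] eq by blast
    have "det U \<noteq> 0"
      using inv U(1) by (auto simp: invertible_det_nz det_mul)
    then have "1 \<le> \<bar>det U\<bar>"
      using U(2) by (rule Ints_nonzero_abs_ge1[rotated])
    then show ?thesis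
      using mult_left_mono[of 1 "\<bar>det U\<bar>" "\<bar>det B\<bar>"] by (simp add: U(1) det_mul abs_mult)
  qed
  show ?thesis
    using le[of A B] le[of B A] assms by simp
qed

lemma lattice_det_matrix_lattice:
  fixes A :: "real ^ 'k::finite ^ 'k"
  assumes "invertible A"
  shows "lattice_det (matrix_lattice A) = \<bar>det A\<bar>"
proof -
  let ?P = "\<lambda>B. invertible B \<and> matrix_lattice A = matrix_lattice B"
  have "?P (SOME B. ?P B)"
    by (rule someI[of ?P A]) (simp add: assms)
  then show ?thesis
    unfolding lattice_det_def using matrix_lattice_eq_imp_abs_det_eq[OF assms] by metis
qed

definition dual_lattice :: "(real ^ 'k::finite) set \<Rightarrow> (real ^ 'k) set" where
  "dual_lattice \<Gamma> = {y. \<forall>x\<in>\<Gamma>. x \<bullet> y \<in> \<int>}"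

definition general_position :: "(real ^ ('d::finite option)) set \<Rightarrow> bool" where
  "general_position \<Gamma> \<longleftrightarrow>
     inj_on p1 \<Gamma> \<and> inj_on p2 \<Gamma> \<and> closure (p1 ` \<Gamma>) = UNIV \<and> closure (p2 ` \<Gamma>) = UNIV"

definition simple_quasicrystal ::
    "(real ^ ('d::finite option)) set \<Rightarrow> real set \<Rightarrow> (real ^ 'd) set" where
  "simple_quasicrystal \<Gamma> I = {p1 \<gamma> | \<gamma>. \<gamma> \<in> \<Gamma> \<and> p2 \<gamma> \<in> I}"

definition riemann_measurable :: "(real ^ 'd::finite) set \<Rightarrow> bool" where
  "riemann_measurable S \<longleftrightarrow> bounded S \<and> frontier S \<in> null_sets lebesgue"

text \<open>
  The pieces \<open>P i\<close> partition \<open>S\<close> exactly, while their translates partition \<open>S'\<close> only up to null sets.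
\<close>

definition equidecomposable ::
    "(real ^ 'd::finite) set \<Rightarrow> (real ^ 'd) set \<Rightarrow> (real ^ 'd) set \<Rightarrow> bool" where
  "equidecomposable G S S' \<longleftrightarrow>
     riemann_measurable S \<and> riemann_measurable S' \<and>
     (\<exists>(n::nat) P v.
        (\<forall>i<n. riemann_measurable (P i) \<and> v i \<in> G) \<and>
        disjoint_family_on P {..<n} \<and> (\<Union>i<n. P i) = S \<and>
        (\<forall>i<n. \<forall>j<n. i \<noteq> j \<longrightarrow>
           ((+) (v i) ` P i) \<inter> ((+) (v j) ` P j) \<in> null_sets lebesgue) \<and>
        sym_diff (\<Union>i<n. (+) (v i) ` P i) S' \<in> null_sets lebesgue)"

definition parallelepiped :: "('d \<Rightarrow> real ^ 'd) \<Rightarrow> (real ^ 'd::finite) set" where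
  "parallelepiped v = {(\<Sum>i\<in>UNIV. t i *\<^sub>R v i) | t. \<forall>i. 0 \<le> t i \<and> t i \<le> 1}"

end

(*
  Choose a basis of the lattice in which a vector \<gamma> with p2 \<gamma> = |I| is a multiple of the last
  basis vector.  The projections of the other vectors of the dual basis, one of them multiplied by
  the same factor, span a parallelepiped Q of volume |I| / det \<Gamma>.  Since p2 is injective on \<Gamma>,
  Kronecker's theorem shows that the projection G of the dual lattice is dense.  If a Riemann
  measurable set X has smaller measure than an open set W, density allows small cubes covering X to
  be moved disjointly into W by vectors of G.  Applying this to a neighbourhood of K and the interior
  of Q, and then to the unused part of Q and the unused part of U, produces S.
*)
theory Submission
  imports Defs
begin

section \<open>Equidecomposition of Riemann measurable sets\<close>

text \<open>Equal measure does not by itself make two sets equidecomposable by vectors of G, so S is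
  not prescribed but assembled from pieces of Q. The strict inequalities mes K < D < mes U supply
  the room: a packing needs a target strictly larger than its source, because density of G places a
  cube only approximately, inside a slightly larger one. Both packings are exact partitions into
  finitely many pieces, so the one starting from Q can be reversed (G is closed under negation) and
  glued to the other; the measure of S is then forced to be that of Q. The hypothesis on |I| is what
  provides a parallelepiped of the right volume: by Cramer's rule the volume spanned by the
  projected dual vectors differs from the density of \<Lambda> by an integer factor only.\<close>

lemma riemann_measurable_iff_negligible:
  "riemann_measurable S \<longleftrightarrow> bounded S \<and> negligible (frontier S)"
  by (simp add: riemann_measurable_def negligible_iff_null_sets)

lemma riemann_measurable_imp_lmeasurable: "riemann_measurable S \<Longrightarrow> S \<in> lmeasurable"
  by (simp add: riemann_measurable_iff_negligible measurable_Jordan)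

lemma riemann_measurable_empty [simp]: "riemann_measurable {}"
  by (simp add: riemann_measurable_def)

lemma riemann_measurable_convex: "bounded S \<Longrightarrow> convex S \<Longrightarrow> riemann_measurable S"
  by (simp add: riemann_measurable_iff_negligible negligible_convex_frontier)

lemma riemann_measurable_Un:
  assumes "riemann_measurable S" "riemann_measurable T"
  shows "riemann_measurable (S \<union> T)"
  using assms negligible_subset[OF _ frontier_Un_subset[of S T]]
  by (simp add: riemann_measurable_iff_negligible)

lemma riemann_measurable_Int:
  assumes "riemann_measurable S" "riemann_measurable T"
  shows "riemann_measurable (S \<inter> T)"
  using assms negligible_subset[OF _ frontier_Int_subset[of S T]]
  by (auto simp: riemann_measurable_iff_negligible bounded_Int)

lemma riemann_measurable_Diff:
  assumes "riemann_measurable S" "riemann_measurable T"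
  shows "riemann_measurable (S - T)"
  using assms negligible_subset[OF _ frontier_Int_subset[of S "- T"]]
  by (auto simp: riemann_measurable_iff_negligible bounded_diff Diff_eq frontier_complement
      intro: bounded_Int)

lemma riemann_measurable_UN:
  assumes "finite A" "\<And>a. a \<in> A \<Longrightarrow> riemann_measurable (S a)"
  shows "riemann_measurable (\<Union>a\<in>A. S a)"
  using assms by (induction rule: finite_induct) (auto intro: riemann_measurable_Un)

lemma riemann_measurable_translation:
  assumes "riemann_measurable S"
  shows "riemann_measurable ((+) v ` S)"
proof -
  have "frontier ((+) v ` S) = (+) v ` frontier S"
    by (simp add: frontier_def closure_translation interior_translation translation_diff)
  then show ?thesis
    using assms
    by (simp add: riemann_measurable_iff_negligible negligible_translation bounded_translation)
qed

lemma emeasure_closure_riemann_measurable: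
  assumes "riemann_measurable S"
  shows "emeasure lebesgue (closure S) = emeasure lebesgue S"
proof -
  have "closure S = S \<union> frontier S"
    using closure_subset by (auto simp: frontier_def interior_subset[THEN subsetD])
  then show ?thesis
    using assms riemann_measurable_imp_lmeasurable[OF assms]
    by (simp add: riemann_measurable_def emeasure_Un_null_set fmeasurableD)
qed

lemma emeasure_lebesgue_translation:
  fixes v :: "'a::euclidean_space"
  assumes "S \<in> lmeasurable"
  shows "emeasure lebesgue ((+) v ` S) = emeasure lebesgue S"
  using assms by (simp add: emeasure_eq_measure2 measurable_translation measure_translation)

section \<open>Exact equidecompositions\<close>

text \<open>Translates are disjoint exactly, not only up to null sets. This makes the relation
  additive over disjoint unions and, for G closed under negation, symmetric; both are plain
  inductions when pieces are added one at a time.\<close>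

inductive exact_equidec ::
    "(real ^ 'd::finite) set \<Rightarrow> (real ^ 'd) set \<Rightarrow> (real ^ 'd) set \<Rightarrow> bool" for G where
  empty: "exact_equidec G {} {}"
| piece: "\<lbrakk>exact_equidec G S T; riemann_measurable P; v \<in> G;
           P \<inter> S = {}; (+) v ` P \<inter> T = {}\<rbrakk>
          \<Longrightarrow> exact_equidec G (P \<union> S) ((+) v ` P \<union> T)"

lemma exact_equidec_riemann_measurable:
  assumes "exact_equidec G S T"
  shows "riemann_measurable S" "riemann_measurable T"
  using assms
  by (induction, simp_all add: riemann_measurable_Un riemann_measurable_translation)

lemma exact_equidec_emeasure:
  assumes "exact_equidec G S T"
  shows "emeasure lebesgue S = emeasure lebesgue T"
  using assms
proof induction
  case (piece S T P v)
  have P: "P \<in> lmeasurable" "(+) v ` P \<in> lmeasurable"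
    using piece.hyps(2)
    by (auto intro: riemann_measurable_imp_lmeasurable riemann_measurable_translation)
  have "S \<in> lmeasurable" "T \<in> lmeasurable"
    using exact_equidec_riemann_measurable[OF piece.hyps(1)]
    by (auto intro: riemann_measurable_imp_lmeasurable)
  then have "emeasure lebesgue (P \<union> S) = emeasure lebesgue P + emeasure lebesgue S"
    "emeasure lebesgue ((+) v ` P \<union> T) = emeasure lebesgue ((+) v ` P) + emeasure lebesgue T"
    using P piece.hyps(4,5) by (simp_all only: plus_emeasure fmeasurableD)
  then show ?case
    using emeasure_lebesgue_translation[OF P(1)] piece.IH by (simp only:)
qed (rule refl)

lemma exact_equidec_Un:
  assumes "exact_equidec G S T" "exact_equidec G S' T'" "S \<inter> S' = {}" "T \<inter> T' = {}"
  shows "exact_equidec G (S \<union> S') (T \<union> T')"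
  using assms
proof induction
  case (piece S T P v)
  have "exact_equidec G (P \<union> (S \<union> S')) ((+) v ` P \<union> (T \<union> T'))"
    by (intro exact_equidec.piece) (use piece in blast)+
  then show ?case
    by (simp add: Un_assoc)
qed simp

lemma exact_equidec_sym:
  assumes "exact_equidec G S T" "\<And>g. g \<in> G \<Longrightarrow> - g \<in> G"
  shows "exact_equidec G T S"
  using assms(1)
proof induction
  case (piece S T P v)
  have P: "(+) (- v) ` (+) v ` P = P"
    unfolding image_image by simp
  have "exact_equidec G ((+) v ` P \<union> T) ((+) (- v) ` (+) v ` P \<union> S)"
    by (intro exact_equidec.piece)
      (use piece assms(2) P riemann_measurable_translation in auto)
  then show ?case
    unfolding P .
qed (rule exact_equidec.empty)

lemma disjoint_family_on_fun_upd:
  fixes n :: nat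
  assumes "disjoint_family_on P {..<n}" "Q \<inter> (\<Union>i<n. P i) = {}"
  shows "disjoint_family_on (P(n := Q)) {..<Suc n}"
proof -
  have "(\<Union>i<n. (P(n := Q)) i) = (\<Union>i<n. P i)"
    by (intro SUP_cong) auto
  moreover have "disjoint_family_on (P(n := Q)) {..<n}"
    using assms(1) unfolding disjoint_family_on_def by simp
  ultimately show ?thesis
    unfolding lessThan_Suc using assms(2) by (subst disjoint_family_on_insert) (simp, simp only: fun_upd_same)
qed

lemma exact_equidec_imp_pieces:
  fixes G :: "(real ^ 'd::finite) set"
  assumes "exact_equidec G S T"
  shows "\<exists>(n::nat) P v. (\<forall>i<n. riemann_measurable (P i) \<and> v i \<in> G) \<and>
           disjoint_family_on P {..<n} \<and> (\<Union>i<n. P i) = S \<and>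
           disjoint_family_on (\<lambda>i. (+) (v i) ` P i) {..<n} \<and> (\<Union>i<n. (+) (v i) ` P i) = T"
  using assms
proof induction
  case empty
  show ?case
    by (intro exI[of _ 0] exI) (simp add: disjoint_family_on_def)
next
  case (piece S T Q w)
  then obtain n :: nat and P v where n: "\<forall>i<n. riemann_measurable (P i) \<and> v i \<in> G"
    "disjoint_family_on P {..<n}" "(\<Union>i<n. P i) = S"
    "disjoint_family_on (\<lambda>i. (+) (v i) ` P i) {..<n}" "(\<Union>i<n. (+) (v i) ` P i) = T"
    by auto
  have upd: "(\<lambda>i. (+) ((v(n := w)) i) ` (P(n := Q)) i) = (\<lambda>i. (+) (v i) ` P i)(n := (+) w ` Q)"
    by (rule ext) simp
  have Un: "(\<Union>i<Suc n. (R(n := X)) i) = X \<union> (\<Union>i<n. R i)"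
    for R :: "nat \<Rightarrow> (real ^ 'd) set" and X
    by (auto simp: lessThan_Suc)
  show ?case
  proof (intro exI[of _ "Suc n"] exI[of _ "P(n := Q)"] exI[of _ "v(n := w)"] conjI)
    show "\<forall>i<Suc n. riemann_measurable ((P(n := Q)) i) \<and> (v(n := w)) i \<in> G"
      using n(1) piece(2,3) by (simp add: less_Suc_eq)
  qed (unfold upd Un,
      use n(2-5) piece(4,5) in \<open>simp_all only: disjoint_family_on_fun_upd\<close>)
qed

lemma exact_equidec_imp_equidecomposable:
  assumes "exact_equidec G S T"
  shows "equidecomposable G S T"
proof -
  obtain n :: nat and P v where n: "\<forall>i<n. riemann_measurable (P i) \<and> v i \<in> G"
    "disjoint_family_on P {..<n}" "(\<Union>i<n. P i) = S"
    "disjoint_family_on (\<lambda>i. (+) (v i) ` P i) {..<n}" "(\<Union>i<n. (+) (v i) ` P i) = T"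
    using exact_equidec_imp_pieces[OF assms] by blast
  show ?thesis
    unfolding equidecomposable_def
    using n exact_equidec_riemann_measurable[OF assms]
    by (intro conjI exI[of _ n] exI[of _ P] exI[of _ v]) (auto simp: disjoint_family_on_def)
qed

section \<open>Grids of half-open cubes\<close>

text \<open>For s > 0 this is the half-open cube with lower corner s * z and side s. The encoding by
  floors makes cells with different indices disjoint and puts every point into the cell indexed by
  its own floors.\<close>

definition cell :: "real \<Rightarrow> ('d \<Rightarrow> int) \<Rightarrow> (real ^ 'd::finite) set" where
  "cell s z = {x. \<forall>i. \<lfloor>x $ i / s\<rfloor> = z i}"

lemma cell_disjoint: "z \<noteq> z' \<Longrightarrow> cell s z \<inter> cell s z' = {}"
  by (auto simp: cell_def)

lemma mem_cell_iff:
  assumes "s > 0"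
  shows "x \<in> cell s z \<longleftrightarrow> (\<forall>i. s * z i \<le> x $ i \<and> x $ i < s * z i + s)"
  using assms by (auto simp: cell_def floor_eq_iff field_simps)

lemma cell_subset_cbox:
  "s > 0 \<Longrightarrow> cell s z \<subseteq> cbox (\<chi> i. s * z i) (\<chi> i. s * z i + s)"
  by (auto simp: mem_cell_iff mem_box_cart less_imp_le)

lemma riemann_measurable_cell:
  assumes "s > 0"
  shows "riemann_measurable (cell s z :: (real ^ 'd::finite) set)"
proof (rule riemann_measurable_convex)
  show "bounded (cell s z :: (real ^ 'd) set)"
    using bounded_cbox cell_subset_cbox[OF assms] by (rule bounded_subset)
  have "cell s z = (\<Inter>i. {x :: real ^ 'd. axis i 1 \<bullet> x \<ge> s * z i} \<inter> {x. axis i 1 \<bullet> x < s * z i + s})"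
    using assms by (auto simp: mem_cell_iff inner_axis inner_commute)
  then show "convex (cell s z :: (real ^ 'd) set)"
    by (simp add: convex_INT convex_Int convex_halfspace_ge convex_halfspace_lt)
qed

lemma measure_cell:
  assumes "s > 0"
  shows "measure lebesgue (cell s z :: (real ^ 'd::finite) set) = s ^ CARD('d)"
proof -
  let ?a = "\<chi> i. s * z i :: real ^ 'd" and ?b = "\<chi> i. s * z i + s :: real ^ 'd"
  have "box ?a ?b \<subseteq> cell s z"
    using assms by (auto simp: mem_cell_iff mem_box_cart less_imp_le)
  then have "negligible ((cbox ?a ?b - cell s z) \<union> (cell s z - cbox ?a ?b))"
    using cell_subset_cbox[OF assms, of z] negligible_frontier_interval[of ?a ?b]
    by (intro negligible_Un) (auto intro: negligible_subset)
  then have "measure lebesgue (cell s z) = measure lborel (cbox ?a ?b)"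
    by (subst measure_negligible_symdiff[of "cbox ?a ?b" "cell s z"]) auto
  moreover have "cbox ?a ?b \<noteq> {}"
    using assms by (simp add: interval_ne_empty_cart)
  ultimately show ?thesis
    by (simp add: content_cbox_cart)
qed

text \<open>The l1 norm dominates the Euclidean one. The constant is crude, but only its
  independence of s and z matters.\<close>

lemma dist_cell:
  fixes s :: real and x y :: "real ^ 'd::finite"
  assumes "s > 0" "x \<in> cell s z" "y \<in> cell s z"
  shows "dist x y \<le> CARD('d) * s"
proof -
  have "\<bar>(x - y) $ i\<bar> \<le> s" for i
    using assms by (simp add: mem_cell_iff abs_le_iff) (smt (verit, best))
  then have "(\<Sum>i\<in>UNIV. \<bar>(x - y) $ i\<bar>) \<le> (\<Sum>i\<in>(UNIV::'d set). s)"
    by (rule sum_mono)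
  then show ?thesis
    using norm_le_l1_cart[of "x - y"] by (simp add: dist_norm)
qed

lemma finite_cells_meeting_bounded:
  fixes B :: "(real ^ 'd::finite) set"
  assumes "s > 0" "bounded B"
  shows "finite {z. cell s z \<inter> B \<noteq> {}}"
proof -
  obtain M where M: "\<And>x. x \<in> B \<Longrightarrow> norm x \<le> M"
    using assms(2) by (auto simp: bounded_iff)
  have "\<lfloor>x $ i / s\<rfloor> \<in> {\<lfloor>- M / s\<rfloor>..\<lfloor>M / s\<rfloor>}" if "x \<in> B" for x i
  proof -
    have "\<bar>x $ i\<bar> \<le> M"
      using component_le_norm_cart[of x i] M[OF that] by linarith
    then show ?thesis
      using assms(1) by (auto intro!: floor_mono simp: divide_right_mono abs_le_iff field_simps)
  qed
  then have "{z. cell s z \<inter> B \<noteq> {}} \<subseteq> PiE UNIV (\<lambda>_. {\<lfloor>- M / s\<rfloor>..\<lfloor>M / s\<rfloor>})"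
    by (force simp: cell_def)
  then show ?thesis
    by (rule finite_subset) (simp add: finite_PiE)
qed

lemma emeasure_cells:
  fixes s :: real and Z :: "('d::finite \<Rightarrow> int) set"
  assumes "s > 0" "finite Z"
  shows "emeasure lebesgue (\<Union>z\<in>Z. cell s z :: (real ^ 'd::finite) set)
           = ennreal (card Z * s ^ CARD('d))"
proof -
  have meas: "(cell s z :: (real ^ 'd) set) \<in> lmeasurable" for z
    using riemann_measurable_cell[OF assms(1)] by (rule riemann_measurable_imp_lmeasurable)
  have "emeasure lebesgue (\<Union>z\<in>Z. cell s z :: (real ^ 'd) set)
          = (\<Sum>z\<in>Z. emeasure lebesgue (cell s z :: (real ^ 'd) set))"
  proof (intro sum_emeasure[symmetric])
    show "disjoint_family_on (\<lambda>z. cell s z :: (real ^ 'd) set) Z"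
      using cell_disjoint unfolding disjoint_family_on_def by blast
  qed (use meas assms(2) in \<open>auto simp: fmeasurableD\<close>)
  also have "\<dots> = (\<Sum>z\<in>Z. ennreal (s ^ CARD('d)))"
    by (simp add: emeasure_eq_measure2 meas measure_cell assms(1))
  also have "\<dots> = ennreal (card Z * s ^ CARD('d))"
    using assms(1) by (simp add: ennreal_mult ennreal_of_nat_eq_real_of_nat)
  finally show ?thesis .
qed

text \<open>A cell that meets C has diameter below e once s < e / \<open>CARD('d)\<close>, so it
  stays inside O'. A threshold for s, and not a single s, is produced because two grids whose sizes
  have a prescribed ratio will be needed at once.\<close>

lemma cells_between_compact_open:
  fixes C O' :: "(real ^ 'd::finite) set"
  assumes "compact C" "open O'" "C \<subseteq> O'"
  obtains \<delta> where "\<delta> > 0" "\<And>s. 0 < s \<Longrightarrow> s < \<delta> \<Longrightarrow>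
    \<exists>Z. finite Z \<and> C \<subseteq> (\<Union>z\<in>Z. cell s z) \<and> (\<Union>z\<in>Z. cell s z) \<subseteq> O'"
proof -
  obtain e where e: "e > 0" "(\<Union>x\<in>C. ball x e) \<subseteq> O'"
    using compact_subset_open_imp_ball_epsilon_subset[OF assms] by metis
  show ?thesis
  proof
    show "e / CARD('d) > 0"
      using e(1) by simp
    fix s :: real assume s: "0 < s" "s < e / CARD('d)"
    let ?Z = "{z. cell s z \<inter> C \<noteq> {}}"
    have "cell s z \<subseteq> O'" if "z \<in> ?Z" for z
    proof
      fix y assume y: "y \<in> cell s z"
      obtain x where x: "x \<in> cell s z" "x \<in> C"
        using \<open>z \<in> ?Z\<close> by auto
      have "CARD('d) * s < e"
        using s(2) by (simp add: field_simps)
      then have "y \<in> ball x e"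
        using dist_cell[OF s(1) x(1) y] by simp
      then show "y \<in> O'"
        using e(2) x(2) by blast
    qed
    moreover have "x \<in> cell s (\<lambda>i. \<lfloor>x $ i / s\<rfloor>)" for x :: "real ^ 'd"
      by (simp add: cell_def)
    ultimately show "\<exists>Z. finite Z \<and> C \<subseteq> (\<Union>z\<in>Z. cell s z) \<and> (\<Union>z\<in>Z. cell s z) \<subseteq> O'"
      using finite_cells_meeting_bounded[OF s(1) compact_imp_bounded[OF assms(1)]]
      by (intro exI[of _ ?Z]) blast
  qed
qed

text \<open>The translations that fit one cell into the other include an open box of side t - s > 0,
  and a dense set meets it.\<close>

lemma dense_translate_cell_into_cell:
  fixes G :: "(real ^ 'd::finite) set"
  assumes "closure G = UNIV" "0 < s" "s < t"
  shows "\<exists>g\<in>G. (+) g ` cell s z \<subseteq> cell t z'"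
proof -
  let ?a = "\<chi> i. t * z' i - s * z i :: real ^ 'd" and ?b = "\<chi> i. t * z' i - s * z i + (t - s) :: real ^ 'd"
  have "box ?a ?b \<noteq> {}"
    using assms(3) by (simp add: interval_ne_empty_cart)
  then obtain g where g: "g \<in> G" "g \<in> box ?a ?b"
    using open_Int_closure_eq_empty[OF open_box, of ?a ?b G] assms(1) by auto
  have "(+) g ` cell s z \<subseteq> cell t z'"
  proof clarify
    fix x assume "x \<in> cell s z"
    then show "g + x \<in> cell t z'"
      using g(2) assms(2,3) by (simp add: mem_cell_iff mem_box_cart) (smt (verit))
  qed
  then show ?thesis
    using g(1) by blast
qed

section \<open>Approximation of measure and packing into open sets\<close>

text \<open>Continuity from below along a compact exhaustion; this also covers W of infinite
  measure.\<close>

lemma compact_inner_emeasure: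
  fixes W :: "'a::euclidean_space set"
  assumes "open W" "c < emeasure lebesgue W"
  obtains C where "compact C" "C \<subseteq> W" "c < emeasure lebesgue C"
proof -
  obtain C :: "nat \<Rightarrow> 'a set" where C: "\<And>n. compact (C n)" "\<And>n. C n \<subseteq> W"
    "\<And>n. C n \<subseteq> interior (C (Suc n))" "(\<Union>n. C n) = W"
    using open_Union_compact_subsets[OF assms(1)] by metis
  have "(SUP n. emeasure lebesgue (C n)) = emeasure lebesgue W"
  proof (subst SUP_emeasure_incseq)
    show "incseq C"
      using C(3) interior_subset by (intro incseq_SucI) blast
  qed (use C in \<open>auto simp: lmeasurable_compact fmeasurableD\<close>)
  then obtain n where "c < emeasure lebesgue (C n)"
    using assms(2) by (auto simp: less_SUP_iff simp flip: \<open>_ = emeasure lebesgue W\<close>)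
  then show ?thesis
    using that C(1,2) by blast
qed

lemma compact_outer_emeasure:
  fixes K :: "'a::euclidean_space set"
  assumes "compact K" "emeasure lebesgue K < ennreal c"
  obtains O' where "open O'" "K \<subseteq> O'" "emeasure lebesgue O' < ennreal c"
proof -
  have K: "K \<in> lmeasurable"
    using assms(1) by (rule lmeasurable_compact)
  then have less: "measure lebesgue K < c"
    using assms(2) by (simp add: emeasure_eq_measure2 ennreal_less_iff)
  then obtain O' where O': "open O'" "K \<subseteq> O'" "O' - K \<in> lmeasurable"
    "emeasure lebesgue (O' - K) < ennreal (c - measure lebesgue K)"
    using sets_lebesgue_outer_open[of K "c - measure lebesgue K"] K by (auto simp: fmeasurableD)
  have "O' = K \<union> (O' - K)"
    using O'(2) by blast
  then have "emeasure lebesgue O' \<le> emeasure lebesgue K + emeasure lebesgue (O' - K)"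
    using emeasure_subadditive[of K lebesgue "O' - K"] K O'(3) by (simp add: fmeasurableD)
  also have "\<dots> < ennreal (measure lebesgue K) + ennreal (c - measure lebesgue K)"
    using K O'(4) by (simp add: emeasure_eq_measure2)
  also have "\<dots> = ennreal c"
    using less by (simp flip: ennreal_plus)
  finally show ?thesis
    using that O'(1,2) by blast
qed

text \<open>Cells of size \<open>s\<close> covering \<open>X\<close> are moved into distinct slightly larger cells contained in \<open>W\<close>;
  the size ratio \<open>r\<close> leaves room for the density of \<open>G\<close> to act.\<close>

lemma exact_equidec_into_open:
  fixes X W G :: "(real ^ 'd::finite) set"
  assumes "closure G = UNIV" "riemann_measurable X" "open W"
    and "emeasure lebesgue X < emeasure lebesgue W"
  obtains T where "T \<subseteq> W" "exact_equidec G X T"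
proof -
  let ?d = "CARD('d)"
  \<comment> \<open>Two finite constants c1 < c2 are placed strictly between the measures: c1 will
    bound from above the total volume of the cells covering X, c2 from below that of the cells found
    inside W.\<close>
  obtain c2' where c2': "emeasure lebesgue X < c2'" "c2' < emeasure lebesgue W"
    using dense[OF assms(4)] by blast
  obtain c1' where c1': "emeasure lebesgue X < c1'" "c1' < c2'"
    using dense[OF c2'(1)] by blast
  obtain c2 where c2: "c2' = ennreal c2" "0 \<le> c2"
    using c2'(2) by (cases c2') auto
  obtain c1 where c1: "c1' = ennreal c1" "0 \<le> c1"
    using c1'(2) c2 by (cases c1') auto
  have c1_pos: "0 < c1" and c12: "c1 < c2"
    using c1 c2 c1' by (auto simp: ennreal_less_iff intro: le_neq_trans)
  \<comment> \<open>Enlarging the side from s to r * s multiplies the volume of a cell by exactly c2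
    / c1. Hence fewer than c1 / s^d small cells face more than c1 / s^d large ones, and an injection
    between them exists.\<close>
  define r where "r = root ?d (c2 / c1)"
  have ratio: "r > 1" "r ^ ?d = c2 / c1"
    using c1_pos c12 by (auto simp: r_def real_root_gt_1_iff real_root_pow_pos2)
  have "compact (closure X)"
    using assms(2) by (simp add: riemann_measurable_def)
  moreover have "emeasure lebesgue (closure X) < ennreal c1"
    using c1 c1'(1) emeasure_closure_riemann_measurable[OF assms(2)] by simp
  ultimately obtain O' where O': "open O'" "closure X \<subseteq> O'" "emeasure lebesgue O' < ennreal c1"
    by (rule compact_outer_emeasure)
  obtain C where C: "compact C" "C \<subseteq> W" "ennreal c2 < emeasure lebesgue C"
    using compact_inner_emeasure[OF assms(3)] c2'(2) c2(1) by blast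
  obtain \<delta>1 where \<delta>1: "\<delta>1 > 0" "\<And>s. 0 < s \<Longrightarrow> s < \<delta>1 \<Longrightarrow>
      \<exists>Z. finite Z \<and> closure X \<subseteq> (\<Union>z\<in>Z. cell s z) \<and> (\<Union>z\<in>Z. cell s z) \<subseteq> O'"
    using cells_between_compact_open[OF \<open>compact (closure X)\<close> O'(1,2)] by blast
  obtain \<delta>2 where \<delta>2: "\<delta>2 > 0" "\<And>s. 0 < s \<Longrightarrow> s < \<delta>2 \<Longrightarrow>
      \<exists>Z. finite Z \<and> C \<subseteq> (\<Union>z\<in>Z. cell s z) \<and> (\<Union>z\<in>Z. cell s z) \<subseteq> W"
    using cells_between_compact_open[OF C(1) assms(3) C(2)] by blast
  obtain s where s: "0 < s" "s < min \<delta>1 (\<delta>2 / r)"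
    using dense[of 0 "min \<delta>1 (\<delta>2 / r)"] \<delta>1(1) \<delta>2(1) ratio(1) by auto
  define t where "t = r * s"
  have t: "0 < t" "s < t" "t < \<delta>2"
    using s ratio(1) by (auto simp: t_def field_simps)
  obtain Z where Z: "finite Z" "closure X \<subseteq> (\<Union>z\<in>Z. cell s z)" "(\<Union>z\<in>Z. cell s z) \<subseteq> O'"
    using \<delta>1(2)[of s] s by auto
  obtain Z' where Z': "finite Z'" "C \<subseteq> (\<Union>z\<in>Z'. cell t z)" "(\<Union>z\<in>Z'. cell t z) \<subseteq> W"
    using \<delta>2(2)[of t] t by auto
  have "ennreal (card Z * s ^ ?d) < ennreal c1"
    using emeasure_mono[OF Z(3), of lebesgue] O'(1,3) emeasure_cells[OF s(1) Z(1)]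
    by (auto intro: le_less_trans)
  then have 1: "card Z * s ^ ?d < c1"
    using s(1) by (simp add: ennreal_less_iff)
  have "(\<Union>z\<in>Z'. cell t z :: (real ^ 'd) set) \<in> sets lebesgue"
    using Z'(1) t(1)
    by (intro fmeasurableD riemann_measurable_imp_lmeasurable riemann_measurable_UN riemann_measurable_cell)
  then have "ennreal c2 < ennreal (card Z' * t ^ ?d)"
    using emeasure_mono[OF Z'(2), of lebesgue] C(3) emeasure_cells[OF t(1) Z'(1)]
    by (auto intro: less_le_trans)
  then have 2: "c2 < card Z' * t ^ ?d"
    using c2(2) by (simp add: ennreal_less_iff)
  have "card Z * s ^ ?d * c2 < c1 * (card Z' * t ^ ?d)"
    using 1 2 c1_pos c12 s(1) by (intro mult_strict_mono) auto
  also have "\<dots> = card Z' * s ^ ?d * c2"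
    using ratio(2) c1_pos by (simp add: t_def power_mult_distrib)
  finally have "card Z \<le> card Z'"
    using s(1) c1_pos c12 by (simp add: mult_less_cancel_right)
  then obtain f where f: "f ` Z \<subseteq> Z'" "inj_on f Z"
    using card_le_inj[OF Z(1) Z'(1)] by blast
  have "\<forall>z. \<exists>g. g \<in> G \<and> (+) g ` cell s z \<subseteq> cell t (f z)"
    using dense_translate_cell_into_cell[OF assms(1) s(1) t(2)] by blast
  from choice[OF this]
  obtain g where g: "\<And>z. g z \<in> G" "\<And>z. (+) (g z) ` cell s z \<subseteq> cell t (f z)"
    by blast
  \<comment> \<open>Stated for all subsets Y of Z so that cells can be added one by one. The
    translated pieces remain disjoint since they lie in the different cells
    \<open>cell t (f z)\<close>.\<close>
  have "exact_equidec G (\<Union>z\<in>Y. X \<inter> cell s z) (\<Union>z\<in>Y. (+) (g z) ` (X \<inter> cell s z))"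
    if "finite Y" "Y \<subseteq> Z" for Y
    using that
  proof (induction rule: finite_induct)
    case empty
    show ?case
      by (simp add: exact_equidec.empty)
  next
    case (insert z Y)
    have "(+) (g z) ` (X \<inter> cell s z) \<inter> (+) (g y) ` (X \<inter> cell s y) = {}" if "y \<in> Y" for y
    proof -
      have "f z \<noteq> f y"
        using insert that f(2) by (metis inj_onD insert_subset subsetD)
      then show ?thesis
        using g(2)[of z] g(2)[of y] cell_disjoint[of "f z" "f y" t] by blast
    qed
    moreover have "(X \<inter> cell s z) \<inter> (X \<inter> cell s y) = {}" if "y \<in> Y" for y
      using cell_disjoint[of z y s] that insert(2) by blast
    ultimately show ?case
      unfolding UN_insert using insert g(1) assms(2) s(1)
      by (intro exact_equidec.piece riemann_measurable_Int riemann_measurable_cell) blast+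
  qed
  from this[OF Z(1) order_refl]
  have "exact_equidec G X (\<Union>z\<in>Z. (+) (g z) ` (X \<inter> cell s z))"
    using Z(2) closure_subset[of X] by (simp add: Int_UN_distrib[symmetric] Int_absorb2)
  moreover have "(\<Union>z\<in>Z. (+) (g z) ` (X \<inter> cell s z)) \<subseteq> W"
    using g(2) f(1) Z'(3) by blast
  ultimately show ?thesis
    using that by blast
qed

text \<open>K itself may have a boundary of positive measure, so it is enlarged to a finite union of
  closed balls. Having even the closure inside V lets the measure of the complement of
  \<open>closure K'\<close> in an open set be computed by additivity.\<close>

lemma riemann_measurable_between_compact_open:
  fixes K V :: "(real ^ 'd::finite) set"
  assumes "compact K" "open V" "K \<subseteq> V"
  obtains K' where "riemann_measurable K'" "K \<subseteq> K'" "closure K' \<subseteq> V"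
proof -
  obtain e where e: "e > 0" "(\<Union>x\<in>K. cball x e) \<subseteq> V"
    using compact_subset_open_imp_cball_epsilon_subset[OF assms] by metis
  obtain F where F: "F \<subseteq> K" "finite F" "K \<subseteq> (\<Union>x\<in>F. ball x e)"
    using compactE_image[OF assms(1), of K "\<lambda>x. ball x e"] e(1) by (metis UN_I centre_in_ball open_ball subsetI)
  show ?thesis
  proof
    show "riemann_measurable (\<Union>x\<in>F. cball x e)"
      using F(2) by (intro riemann_measurable_UN riemann_measurable_convex) auto
    have "(\<Union>x\<in>F. cball x e) \<subseteq> V"
      using e(2) F(1) by blast
    then show "closure (\<Union>x\<in>F. cball x e) \<subseteq> V"
      using F(2) by (simp add: closure_closed closed_UN)
    show "K \<subseteq> (\<Union>x\<in>F. cball x e)"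
      using F(3) ball_subset_cball by blast
  qed
qed

text \<open>First the neighbourhood \<open>K'\<close> of \<open>K\<close> is packed into \<open>Q\<close>, then what remains of \<open>Q\<close> is packed
  into \<open>U\<close> outside \<open>K'\<close>.\<close>

lemma exact_equidec_between_compact_open:
  fixes G K U Q :: "(real ^ 'd::finite) set"
  assumes "closure G = UNIV" "\<And>g. g \<in> G \<Longrightarrow> - g \<in> G"
    and "compact K" "open U" "K \<subseteq> U" "riemann_measurable Q"
    and "emeasure lebesgue K < emeasure lebesgue Q" "emeasure lebesgue Q < emeasure lebesgue U"
  obtains S where "K \<subseteq> S" "S \<subseteq> U" "exact_equidec G S Q"
proof -
  have Q: "Q \<in> lmeasurable"
    using assms(6) by (rule riemann_measurable_imp_lmeasurable)
  obtain V where V: "open V" "K \<subseteq> V" "emeasure lebesgue V < emeasure lebesgue Q"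
    using compact_outer_emeasure[OF assms(3), of "measure lebesgue Q"] assms(7) Q
    by (metis emeasure_eq_measure2)
  obtain K' where K': "riemann_measurable K'" "K \<subseteq> K'" "closure K' \<subseteq> U \<inter> V"
    using riemann_measurable_between_compact_open[OF assms(3), of "U \<inter> V"] assms(4,5) V by auto
  have K'_meas: "K' \<in> lmeasurable"
    using K'(1) by (rule riemann_measurable_imp_lmeasurable)
  \<comment> \<open>A packing needs an open target; passing to the interior loses only the null
    frontier.\<close>
  have "interior Q = Q - frontier Q"
    using closure_subset interior_subset by (fastforce simp: frontier_def)
  then have "emeasure lebesgue (interior Q) = emeasure lebesgue Q"
    using assms(6) Q by (simp add: riemann_measurable_def emeasure_Diff_null_set fmeasurableD)
  moreover have "emeasure lebesgue K' \<le> emeasure lebesgue V"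
    using K'(3) closure_subset[of K'] V(1) by (intro emeasure_mono) auto
  ultimately have "emeasure lebesgue K' < emeasure lebesgue (interior Q)"
    using V(3) by simp
  then obtain T where T: "T \<subseteq> interior Q" "exact_equidec G K' T"
    using exact_equidec_into_open[OF assms(1) K'(1) open_interior] by metis
  have T_rm: "riemann_measurable T" and T_meas: "T \<in> lmeasurable"
    and T_eq: "emeasure lebesgue T = emeasure lebesgue K'"
    using exact_equidec_riemann_measurable[OF T(2)] exact_equidec_emeasure[OF T(2)]
    by (auto intro: riemann_measurable_imp_lmeasurable)
  have "T \<subseteq> Q"
    using T(1) interior_subset by blast
  \<comment> \<open>U may have infinite measure, so the inequality is obtained by adding equal
    measures to both sides and not by subtraction.\<close>
  have "emeasure lebesgue (Q - T) < emeasure lebesgue (U - closure K')"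
  proof (rule ccontr)
    assume "\<not> ?thesis"
    then have "emeasure lebesgue (U - closure K') + emeasure lebesgue (closure K')
        \<le> emeasure lebesgue (Q - T) + emeasure lebesgue T"
      using T_eq emeasure_closure_riemann_measurable[OF K'(1)] by (intro add_mono) auto
    moreover have "emeasure lebesgue (U - closure K') + emeasure lebesgue (closure K')
        = emeasure lebesgue U"
      using K'(3) assms(4)
      by (subst plus_emeasure) (auto simp: Un_absorb2 intro!: arg_cong[of _ _ "emeasure lebesgue"])
    moreover have "emeasure lebesgue (Q - T) + emeasure lebesgue T = emeasure lebesgue Q"
      using \<open>T \<subseteq> Q\<close> Q T_meas
      by (subst plus_emeasure) (auto simp: fmeasurableD Un_absorb2)
    ultimately show False
      using assms(8) by simp
  qed
  then obtain T' where T': "T' \<subseteq> U - closure K'" "exact_equidec G (Q - T) T'"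
    using exact_equidec_into_open[OF assms(1) riemann_measurable_Diff[OF assms(6) T_rm], of "U - closure K'"]
      assms(4) by (metis closed_closure open_Diff)
  \<comment> \<open>The second packing leads out of Q and is reversed here, so that both parts run
    from S to Q.\<close>
  have "exact_equidec G (K' \<union> T') (T \<union> (Q - T))"
    using T(2) exact_equidec_sym[OF T'(2) assms(2)] T'(1) closure_subset[of K']
    by (intro exact_equidec_Un) auto
  moreover have "T \<union> (Q - T) = Q"
    using \<open>T \<subseteq> Q\<close> by blast
  ultimately show ?thesis
    using K'(2,3) T'(1) closure_subset[of K'] by (intro that[of "K' \<union> T'"]) auto
qed

section \<open>Volume of parallelepipeds\<close>

text \<open>A swap preserves the norm, so its determinant is 1 or -1, and it sends a box to the box
  with permuted sides. Agreement on boxes extends to all measurable sets.\<close>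

lemma measure_swap_coordinates:
  fixes m n :: "'n::finite"
  defines "h \<equiv> \<lambda>x :: real ^ 'n. \<chi> i. x $ Transposition.transpose m n i"
  shows "\<forall>S \<in> lmeasurable. h ` S \<in> lmeasurable \<and>
    measure lebesgue (h ` S) = \<bar>det (matrix h)\<bar> * measure lebesgue S"
proof -
  let ?t = "Transposition.transpose m n"
  have t: "bij ?t"
    by simp
  have nth: "h x $ i = x $ ?t i" for x i
    by (simp add: h_def)
  have hh: "h (h x) = x" for x
    by (simp add: vec_eq_iff nth)
  have lin: "linear h"
    by (rule linearI) (simp_all add: vec_eq_iff nth)
  have "norm (h x) = norm x" for x
    unfolding norm_vec_def L2_set_def nth
    using sum.reindex_bij_betw[OF t, of "\<lambda>i. (norm (x $ i))\<^sup>2"] by (simp only:)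
  then have "orthogonal_transformation h"
    using lin by (simp add: orthogonal_transformation)
  then have det: "\<bar>det (matrix h)\<bar> = 1"
    by (rule orthogonal_transformation_det)
  have meas: "measure lebesgue (h ` cbox a b) = 1 * measure lebesgue (cbox a b)" for a b
  proof -
    have mono: "h x \<in> cbox (h a) (h b)" if "x \<in> cbox a b" for x a b
      using that by (simp add: mem_box_cart nth)
    have "h ` cbox a b = cbox (h a) (h b)"
    proof (intro equalityI subsetI)
      fix y assume "y \<in> cbox (h a) (h b)"
      from mono[OF this] have "h y \<in> cbox a b"
        by (simp only: hh)
      then show "y \<in> h ` cbox a b"
        by (intro image_eqI[of _ _ "h y"]) (simp_all only: hh)
    qed (use mono in blast)
    moreover have "(\<Prod>i\<in>UNIV. h b $ i - h a $ i) = (\<Prod>i\<in>UNIV. b $ i - a $ i)"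
      unfolding nth by (rule prod.reindex_bij_betw[OF t])
    moreover have "cbox (h a) (h b) = {} \<longleftrightarrow> cbox a b = {}"
      using calculation(1) by (metis image_is_empty)
    ultimately show ?thesis
      by (simp add: content_cbox_if_cart)
  qed
  show ?thesis
  proof
    fix S :: "(real ^ 'n) set" assume "S \<in> lmeasurable"
    from measure_linear_sufficient[OF lin this meas] det
    show "h ` S \<in> lmeasurable \<and> measure lebesgue (h ` S) = \<bar>det (matrix h)\<bar> * measure lebesgue S"
      by simp
  qed
qed

lemma measure_shear:
  fixes m n :: "'n::finite"
  assumes mn: "m \<noteq> n"
  defines "h \<equiv> \<lambda>x :: real ^ 'n. \<chi> i. if i = m then x $ m + x $ n else x $ i"
  shows "\<forall>S \<in> lmeasurable. h ` S \<in> lmeasurable \<and>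
    measure lebesgue (h ` S) = \<bar>det (matrix h)\<bar> * measure lebesgue S"
proof -
  have nth: "h x $ i = (if i = m then x $ m + x $ n else x $ i)" for x i
    by (simp add: h_def)
  have lin: "linear h"
    by (rule linearI) (simp_all add: vec_eq_iff nth algebra_simps)
  have "matrix h = (\<chi> k. if k = m then row m (mat 1) + 1 *s row n (mat 1) else row k (mat 1))"
    by (simp add: vec_eq_iff matrix_def nth axis_def row_def mat_def)
  then have det: "det (matrix h) = 1"
    using det_row_operation[OF mn, of "mat 1 :: real ^ 'n ^ 'n" 1] by simp
  have meas: "measure lebesgue (h ` cbox a b) = 1 * measure lebesgue (cbox a b)" for a b
  proof (cases "cbox a b = {}")
    case False
    \<comment> \<open>Translating by w brings the n-th lower bound of the box to 0;
      \<open>measure_shear_interval\<close> asks for a non-negative one.\<close>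
    define w where "w = axis n (a $ n)"
    have w: "cbox a b = (+) w ` cbox (a - w) (b - w)"
      by (simp add: cbox_translation[symmetric])
    have ne: "cbox (a - w) (b - w) \<noteq> {}"
      using False unfolding w by blast
    have "h ` (+) w ` A = (+) (h w) ` h ` A" for A
      unfolding image_image by (simp only: linear_add[OF lin])
    then have "measure lebesgue (h ` cbox a b) = measure lebesgue (h ` cbox (a - w) (b - w))"
      unfolding w by (simp only: measure_translation)
    also have "\<dots> = measure lebesgue (cbox (a - w) (b - w))"
      unfolding h_def using ne mn by (intro measure_shear_interval) (simp_all add: w_def)
    also have "\<dots> = measure lebesgue (cbox a b)"
      unfolding w by (simp only: measure_translation)
    finally show ?thesis
      by simp
  qed simp
  show ?thesis
  proof
    fix S :: "(real ^ 'n) set" assume "S \<in> lmeasurable"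
    from measure_linear_sufficient[OF lin this meas] det
    show "h ` S \<in> lmeasurable \<and> measure lebesgue (h ` S) = \<bar>det (matrix h)\<bar> * measure lebesgue S"
      by simp
  qed
qed

text \<open>The library's \<open>measure_linear_image\<close> is restricted to well-ordered index types.\<close>

lemma measure_linear_image_finite:
  fixes f :: "real ^ 'n::finite \<Rightarrow> real ^ 'n"
  assumes "linear f" "S \<in> lmeasurable"
  shows "f ` S \<in> lmeasurable \<and> measure lebesgue (f ` S) = \<bar>det (matrix f)\<bar> * measure lebesgue S"
proof -
  let ?P = "\<lambda>f :: real ^ 'n \<Rightarrow> real ^ 'n. \<forall>S \<in> lmeasurable.
    f ` S \<in> lmeasurable \<and> measure lebesgue (f ` S) = \<bar>det (matrix f)\<bar> * measure lebesgue S"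
  have "?P f"
    using assms(1)
  proof (rule induct_linear_elementary)
    fix f g :: "real ^ 'n \<Rightarrow> real ^ 'n"
    assume "linear f" "linear g" "?P f" "?P g"
    then show "?P (f \<circ> g)"
      unfolding image_comp[symmetric] by (simp add: matrix_compose det_mul abs_mult)
  next
    fix f :: "real ^ 'n \<Rightarrow> real ^ 'n" and i
    assume f: "linear f" "\<And>x. f x $ i = 0"
    \<comment> \<open>A vanishing coordinate rules out surjectivity, hence injectivity: the image is
      negligible and the determinant is 0, so both sides vanish.\<close>
    have "\<not> surj f"
    proof
      assume "surj f"
      then obtain x where "f x = axis i 1"
        by (metis surjD)
      then show False
        using f(2)[of x] by (simp add: axis_def)
    qed
    then have "\<not> inj f"
      using f(1) linear_injective_imp_surjective by blast
    then have "negligible (f ` S)" "det (matrix f) = 0" for S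
      using f(1) negligible_linear_singular_image det_nz_iff_inj by blast+
    then show "?P f"
      by (simp add: negligible_iff_measure)
  next
    fix c :: "'n \<Rightarrow> real"
    show "?P (\<lambda>x. \<chi> i. c i * x $ i)"
      by (simp add: measurable_stretch measure_stretch matrix_def axis_def det_diagonal)
  qed (rule measure_swap_coordinates measure_shear, assumption?)+
  then show ?thesis
    using assms(2) by blast
qed

lemma parallelepiped_eq_image:
  "parallelepiped v = (\<lambda>t. \<Sum>i\<in>UNIV. t $ i *\<^sub>R v i) ` cbox 0 1"
proof -
  have "x \<in> (\<lambda>t. \<Sum>i\<in>UNIV. t $ i *\<^sub>R v i) ` cbox 0 1"
    if "x = (\<Sum>i\<in>UNIV. t i *\<^sub>R v i)" "\<forall>i. 0 \<le> t i \<and> t i \<le> 1" for x t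
    using that by (intro image_eqI[of _ _ "\<chi> i. t i"]) (auto simp: mem_box_cart)
  then show ?thesis
    unfolding parallelepiped_def by (auto simp: mem_box_cart)
qed

lemma linear_sum_scaleR_nth: "linear (\<lambda>t. \<Sum>i\<in>UNIV. t $ i *\<^sub>R v i)"
  by (intro linear_compose_sum ballI linearI) (simp_all add: scaleR_left_distrib)

lemma matrix_sum_scaleR_nth:
  "matrix (\<lambda>t. \<Sum>i\<in>UNIV. t $ i *\<^sub>R v i) = transpose (\<chi> i. v i)"
  by (simp add: vec_eq_iff matrix_def transpose_def axis_def if_distrib[of "\<lambda>x. x * _"] cong: if_cong)

lemma convex_bounded_parallelepiped:
  "convex (parallelepiped v)" "bounded (parallelepiped v)"
  unfolding parallelepiped_eq_image
  by (simp_all add: convex_linear_image bounded_linear_image linear_linear linear_sum_scaleR_nth)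

lemma emeasure_parallelepiped:
  "emeasure lebesgue (parallelepiped v) = ennreal \<bar>det (\<chi> i. v i)\<bar>"
proof -
  have "measure lborel (cbox 0 1 :: (real ^ 'a) set) = 1"
    by (simp add: content_cbox_if_cart interval_eq_empty_cart)
  then have "parallelepiped v \<in> lmeasurable"
    "measure lebesgue (parallelepiped v) = \<bar>det (\<chi> i. v i)\<bar>"
    using measure_linear_image_finite[OF linear_sum_scaleR_nth[of v], of "cbox 0 1"]
    by (simp_all add: parallelepiped_eq_image matrix_sum_scaleR_nth det_transpose)
  then show ?thesis
    by (simp only: emeasure_eq_measure2)
qed

section \<open>Lattice bases and density of the projected dual lattice\<close>

lemma matrix_lattice_mult_unimodular:
  fixes A E E' :: "real ^ 'k::finite ^ 'k"
  assumes "\<And>i j. E $ i $ j \<in> \<int>" "\<And>i j. E' $ i $ j \<in> \<int>" "E ** E' = mat 1"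
  shows "matrix_lattice (A ** E) = matrix_lattice A"
proof -
  have int: "\<forall>i. (X *v z) $ i \<in> \<int>"
    if "\<And>i j. X $ i $ j \<in> \<int>" "\<forall>i. z $ i \<in> \<int>" for X :: "real ^ 'k ^ 'k" and z
    using that by (auto simp: matrix_vector_mult_def intro!: Ints_sum Ints_mult)
  have 1: "A *v z = (A ** E) *v (E' *v z)" for z
    using assms(3) by (simp add: matrix_vector_mul_assoc flip: matrix_mul_assoc)
  have 2: "(A ** E) *v z = A *v (E *v z)" for z
    by (simp add: matrix_vector_mul_assoc)
  show ?thesis
    unfolding matrix_lattice_def
  proof (intro equalityI image_subsetI)
    fix z :: "real ^ 'k" assume "z \<in> {z. \<forall>i. z $ i \<in> \<int>}"
    then show "(A ** E) *v z \<in> (\<lambda>z. A *v z) ` {z. \<forall>i. z $ i \<in> \<int>}"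
      using int[OF assms(1), of z] by (intro image_eqI[where x = "E *v z"] 2) simp
  next
    fix z :: "real ^ 'k" assume "z \<in> {z. \<forall>i. z $ i \<in> \<int>}"
    then show "A *v z \<in> (\<lambda>z. (A ** E) *v z) ` {z. \<forall>i. z $ i \<in> \<int>}"
      using int[OF assms(2), of z] by (intro image_eqI[where x = "E' *v z"] 1) simp
  qed
qed

text \<open>Euclid's algorithm on the coordinates \<open>z\<close>, by column operations on the basis.\<close>

lemma matrix_lattice_basis_multiple:
  fixes A :: "real ^ 'k::finite ^ 'k" and z :: "'k \<Rightarrow> int"
  assumes "invertible A"
  shows "\<exists>B m. invertible B \<and> matrix_lattice B = matrix_lattice A \<and>
           A *v (\<chi> i. of_int (z i)) = B *v axis l (of_int m)"
  using assms
proof (induction "nat (\<Sum>i\<in>UNIV. \<bar>z i\<bar>)" arbitrary: A z rule: less_induct)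
  case less
  show ?case
  proof (cases "\<exists>i j. i \<noteq> j \<and> z i \<noteq> 0 \<and> z j \<noteq> 0")
    case True
    then obtain i j where ij: "i \<noteq> j" "z i \<noteq> 0" "z j \<noteq> 0" "\<bar>z j\<bar> \<le> \<bar>z i\<bar>"
      by (metis linear)
    \<comment> \<open>With this sign, subtracting s * z j lowers the absolute value of z i by
      exactly that of z j, which is positive.\<close>
    define s where "s = sgn (z i) * sgn (z j)"
    define z' where "z' = z(i := z i - s * z j)"
    \<comment> \<open>\<open>E s\<close> adds s times coordinate j to coordinate i and has inverse
      \<open>E (- s)\<close>. So \<open>A ** E s\<close> is another basis of the lattice, and the
      given vector has coordinates z' in it.\<close>
    define E :: "int \<Rightarrow> real ^ 'k ^ 'k"
      where "E = (\<lambda>s. \<chi> p q. of_bool (p = q) + (if p = i \<and> q = j then of_int s else 0))"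
    have E: "E s *v x = (\<chi> p. x $ p + (if p = i then of_int s * x $ j else 0))" for s x
      by (simp add: vec_eq_iff matrix_vector_mult_def E_def distrib_right sum.distrib
          of_bool_def if_distrib[of "\<lambda>x. x * _"] cong: if_cong)
    have inv: "E s ** E (- s) = mat 1" for s
      using ij(1) by (simp add: matrix_eq matrix_vector_mul_assoc[symmetric] E vec_eq_iff)
    have int: "E s $ p $ q \<in> \<int>" for s p q
      by (simp add: E_def)
    have "\<bar>z i - s * z j\<bar> = \<bar>z i\<bar> - \<bar>z j\<bar>"
      using ij(2-4) by (auto simp: s_def sgn_if abs_if)
    then have "\<bar>z' i\<bar> < \<bar>z i\<bar>"
      using ij(3) by (simp add: z'_def)
    moreover have "(\<Sum>p\<in>UNIV. \<bar>y p\<bar>) = \<bar>y i\<bar> + (\<Sum>p\<in>UNIV - {i}. \<bar>y p\<bar>)" for y :: "'k \<Rightarrow> int"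
      by (rule sum.remove) auto
    moreover have "(\<Sum>p\<in>UNIV - {i}. \<bar>z' p\<bar>) = (\<Sum>p\<in>UNIV - {i}. \<bar>z p\<bar>)"
      by (rule sum.cong) (auto simp: z'_def)
    ultimately have "(\<Sum>p\<in>UNIV. \<bar>z' p\<bar>) < (\<Sum>p\<in>UNIV. \<bar>z p\<bar>)"
      by simp
    moreover have "0 \<le> (\<Sum>p\<in>UNIV. \<bar>z' p\<bar>)"
      by (simp add: sum_nonneg)
    ultimately have "nat (\<Sum>p\<in>UNIV. \<bar>z' p\<bar>) < nat (\<Sum>p\<in>UNIV. \<bar>z p\<bar>)"
      by linarith
    moreover have "invertible (A ** E s)"
      using less.prems inv[of s] inv[of "- s"] by (intro invertible_mult) (auto simp: invertible_def)
    ultimately obtain B m where B: "invertible B" "matrix_lattice B = matrix_lattice (A ** E s)"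
      "(A ** E s) *v (\<chi> i. of_int (z' i)) = B *v axis l (of_int m)"
      using less.hyps[of z' "A ** E s"] by blast
    have "E s *v (\<chi> i. of_int (z' i)) = (\<chi> i. of_int (z i))"
      using ij(1) by (simp add: E vec_eq_iff z'_def)
    then have "A *v (\<chi> i. of_int (z i)) = B *v axis l (of_int m)"
      using B(3) by (simp flip: matrix_vector_mul_assoc)
    then show ?thesis
      using B(1,2) matrix_lattice_mult_unimodular[OF int int inv, of A s] by auto
  next
    case False
    \<comment> \<open>At most one coordinate is non-zero, the one at k (any index if z vanishes).
      Exchanging columns k and l of A moves it to position l.\<close>
    then obtain k where k: "\<And>i. i \<noteq> k \<Longrightarrow> z i = 0"
      by metis
    define E :: "real ^ 'k ^ 'k" where "E = (\<chi> p q. of_bool (q = Transposition.transpose k l p))"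
    have E: "E *v x = (\<chi> p. x $ Transposition.transpose k l p)" for x
      by (simp add: vec_eq_iff matrix_vector_mult_def E_def of_bool_def if_distrib[of "\<lambda>x. x * _"] cong: if_cong)
    have inv: "E ** E = mat 1"
      by (simp add: matrix_eq matrix_vector_mul_assoc[symmetric] E vec_eq_iff)
    have int: "E $ p $ q \<in> \<int>" for p q
      by (simp add: E_def)
    have "E *v axis l (of_int (z k)) = (\<chi> i. of_int (z i))"
      using k by (auto simp: E vec_eq_iff axis_def transpose_eq_iff Transposition.transpose_def)
    then have "A *v (\<chi> i. of_int (z i)) = (A ** E) *v axis l (of_int (z k))"
      by (simp flip: matrix_vector_mul_assoc)
    moreover have "invertible (A ** E)"
      using less.prems inv by (intro invertible_mult) (auto simp: invertible_def)
    ultimately show ?thesis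
      using matrix_lattice_mult_unimodular[OF int int inv, of A] by blast
  qed
qed

section \<open>Minors of the inverse matrix\<close>

text \<open>In the Leibniz sum a permutation moving \<open>None\<close> meets a zero entry of row
  \<open>None\<close>. The others extend permutations of the smaller index type by a fixed point,
  which keeps the sign.\<close>

lemma det_option_block:
  fixes C :: "'a::comm_ring_1 ^ ('d::finite option) ^ ('d option)"
  assumes "C $ None = axis None 1"
  shows "det C = det (\<chi> i j. C $ Some i $ Some j :: 'a ^ 'd ^ 'd)"
proof -
  let ?M = "\<chi> i j. C $ Some i $ Some j :: 'a ^ 'd ^ 'd"
  let ?e = "map_permutation UNIV (Some :: 'd \<Rightarrow> 'd option)"
  let ?t = "\<lambda>p. of_int (sign p) * (\<Prod>i\<in>UNIV. C $ i $ p i)"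
  have UNIV_eq: "(\<Prod>i\<in>UNIV. f i) = f None * (\<Prod>i\<in>UNIV. f (Some i))" for f :: "'d option \<Rightarrow> 'a"
    by (simp add: UNIV_option_conv prod.reindex)
  have bij: "bij_betw (Some :: 'd \<Rightarrow> 'd option) UNIV (range Some)"
    "bij_betw the (range (Some :: 'd \<Rightarrow> 'd option)) UNIV"
    by (auto simp: bij_betw_def inj_on_def image_image)
  have e: "?e p permutes range Some" "?e p None = None" "?e p (Some i) = Some (p i)"
    if "p permutes UNIV" for p i
  proof -
    show 1: "?e p permutes range Some"
      by (rule map_permutation_permutes[OF bij(1) that])
    show "?e p None = None"
      using permutes_not_in[OF 1] by simp
    show "?e p (Some i) = Some (p i)"
      by (rule map_permutation_apply) auto
  qed
  have "det C = (\<Sum>p\<in>{p. p permutes UNIV}. ?t p)"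
    by (simp add: det_def)
  also have "\<dots> = (\<Sum>p\<in>{p. p permutes range Some}. ?t p)"
  proof (rule sum.mono_neutral_right)
    show "\<forall>p\<in>{p. p permutes UNIV} - {p. p permutes range Some}. ?t p = 0"
    proof
      fix p :: "'d option \<Rightarrow> 'd option"
      assume p: "p \<in> {p. p permutes UNIV} - {p. p permutes range Some}"
      have "p None \<noteq> None"
      proof
        assume "p None = None"
        then have "p permutes range Some"
          using p by (auto intro!: permutes_superset[of p UNIV] simp: notin_range_Some)
        then show False
          using p by simp
      qed
      then obtain q where "p None = Some q"
        by blast
      then show "?t p = 0"
        using assms by (simp add: UNIV_eq axis_def)
    qed
  qed (auto simp: finite_permutations intro: permutes_subset)
  also have "\<dots> = (\<Sum>p\<in>{p. p permutes UNIV}. ?t (?e p))"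
  proof (rule sum.reindex_bij_betw[symmetric])
    show "bij_betw ?e {p. p permutes UNIV} {p. p permutes range Some}"
    proof (rule bij_betwI[where g = "map_permutation (range Some) the"])
      show "map_permutation (range Some) the (?e p) = p" if "p \<in> {p. p permutes UNIV}" for p
        using that bij by (intro map_permutation_compose_inv) auto
      show "?e (map_permutation (range Some) the q) = q" if "q \<in> {p. p permutes range Some}" for q
        using that bij by (intro map_permutation_compose_inv) auto
      show "?e \<in> {p. p permutes UNIV} \<rightarrow> {p. p permutes range Some}"
        using e(1) by blast
      show "map_permutation (range Some) the \<in> {p. p permutes range (Some :: 'd \<Rightarrow> 'd option)} \<rightarrow> {p. p permutes UNIV}"
        using map_permutation_permutes[OF bij(2)] by blast
    qed
  qed
  also have "\<dots> = (\<Sum>p\<in>{p. p permutes UNIV}. of_int (sign p) * (\<Prod>i\<in>UNIV. ?M $ i $ p i))"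
    using assms by (intro sum.cong) (auto simp: UNIV_eq e sign_map_permutation axis_def)
  finally show ?thesis
    by (simp add: det_def)
qed

text \<open>Jacobi's identity for a complementary minor of the inverse. With row \<open>None\<close>
  of B replaced by the unit vector, the product with A is the identity matrix with row
  \<open>None\<close> replaced by that of A; its determinant is one diagonal entry.\<close>

lemma det_minor_of_inverse:
  fixes A B :: "'a::field ^ ('d::finite option) ^ ('d option)"
  assumes "B ** A = mat 1"
  shows "det (\<chi> i j. B $ Some i $ Some j :: 'a ^ 'd ^ 'd) * det A = A $ None $ None"
proof -
  let ?C = "\<chi> i. if i = None then axis None 1 else B $ i"
  have rows: "(?C ** A) $ i = (if i = None then row None A else row i (mat 1))" for i
  proof (cases i)
    case None
    then show ?thesis
      by (simp add: vec_eq_iff matrix_matrix_mult_def row_def axis_def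
          if_distrib[of "\<lambda>x. x * _"] cong: if_cong)
  next
    case (Some k)
    then have "(?C ** A) $ i = (B ** A) $ i"
      by (simp add: vec_eq_iff matrix_matrix_mult_def)
    then show ?thesis
      using assms Some by (simp add: vec_eq_iff row_def)
  qed
  have "(\<Sum>i\<in>UNIV. row None A $ i *s row i (mat 1)) = row None A"
    by (simp add: vec_eq_iff row_def mat_def if_distrib[of "\<lambda>x. _ * x"] cong: if_cong)
  with rows have "?C ** A = (\<chi> i. if i = None then sum (\<lambda>i. row None A $ i *s row i (mat 1)) UNIV
      else row i (mat 1))"
    by (simp only: vec_eq_iff[of "?C ** A"] vec_lambda_beta) simp
  then have "det (?C ** A) = A $ None $ None"
    by (simp only: cramer_lemma_transpose) (simp add: row_def)
  then show ?thesis
    using det_option_block[of ?C] by (simp add: det_mul)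
qed

section \<open>Kronecker approximation\<close>

text \<open>Kronecker's theorem moved from initial segments of the naturals to a finite index type.
  The hypothesis is linear independence of the \<open>\<tau> i\<close> and 1 over the integers: once
  c = 0, also k = 0.\<close>

lemma Kronecker_finite:
  fixes \<tau> \<alpha> :: "'d::finite \<Rightarrow> real"
  assumes indep: "\<And>(c :: 'd \<Rightarrow> int) (k::int). (\<Sum>i\<in>UNIV. of_int (c i) * \<tau> i) + of_int k = 0 \<Longrightarrow> c = (\<lambda>_. 0)"
    and "\<epsilon> > 0"
  obtains k m where "\<And>i. \<bar>of_int k * \<tau> i - of_int (m i) - \<alpha> i\<bar> < \<epsilon>"
proof -
  let ?n = "CARD('d)"
  obtain e :: "nat \<Rightarrow> 'd" where e: "bij_betw e {..<?n} UNIV"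
    using ex_bij_betw_nat_finite[of "UNIV :: 'd set"] by (auto simp: atLeast0LessThan)
  \<comment> \<open>\<open>\<theta>\<close> enumerates the \<open>\<tau> i\<close> and has the value
    1 at the last index \<open>CARD('d)\<close>, as \<open>Kronecker_thm_2\<close> expects.\<close>
  define \<theta> where "\<theta> = (\<lambda>i. if i < ?n then \<tau> (e i) else 1)"
  interpret Modules.module "\<lambda>r x. real_of_int r * x"
    by unfold_locales (simp_all add: algebra_simps)
  \<comment> \<open>Independence of a set of values does not see repetitions, so injectivity of
    \<open>\<theta>\<close> is shown separately: no \<open>\<tau> i\<close> is an integer, in
    particular none is 1, and no two coincide.\<close>
  have \<tau>_not_int: "\<tau> i \<noteq> of_int k" for i k
  proof
    assume "\<tau> i = of_int k"
    then have "(\<lambda>j. of_bool (j = i) :: int) = (\<lambda>_. 0)"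
      by (intro indep[of _ "- k"]) (simp add: of_bool_def if_distrib[of real_of_int] if_distrib[of "\<lambda>x. x * _"] cong: if_cong)
    from fun_cong[OF this, of i] show False
      by simp
  qed
  have \<tau>_inj: "i = j" if "\<tau> i = \<tau> j" for i j
  proof (rule ccontr)
    assume "i \<noteq> j"
    have "(\<Sum>p\<in>UNIV. of_int (of_bool (p = i) - of_bool (p = j)) * \<tau> p) = \<tau> i - \<tau> j"
      by (simp add: left_diff_distrib sum_subtractf of_bool_def if_distrib[of real_of_int] if_distrib[of "\<lambda>x. x * _"] cong: if_cong)
    then have "(\<lambda>p. of_bool (p = i) - of_bool (p = j) :: int) = (\<lambda>_. 0)"
      using indep[of "\<lambda>p. of_bool (p = i) - of_bool (p = j)" 0] that by simp
    from fun_cong[OF this, of i] show False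
      using \<open>i \<noteq> j\<close> by simp
  qed
  have inj: "inj_on \<theta> {..?n}"
  proof (rule inj_onI)
    fix i j assume "i \<in> {..?n}" "j \<in> {..?n}" "\<theta> i = \<theta> j"
    then show "i = j"
      using \<tau>_not_int[of _ 1] \<tau>_inj bij_betw_imp_inj_on[OF e]
      by (auto simp: \<theta>_def inj_on_def split: if_splits)
  qed
  have "independent (\<theta> ` {..?n})"
    unfolding independent_explicit_module
  proof (intro allI impI)
    fix t and u :: "real \<Rightarrow> int" and v
    assume t: "finite t" "t \<subseteq> \<theta> ` {..?n}" "(\<Sum>v\<in>t. of_int (u v) * v) = 0" "v \<in> t"
    \<comment> \<open>Coefficients are extended by 0 outside t, which turns a relation on a subset
      into one over the whole family.\<close>
    define w where "w = (\<lambda>x. if x \<in> t then u x else 0)"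
    have "0 = (\<Sum>v\<in>t. of_int (w v) * v)"
      using t(3) by (simp add: w_def)
    also have "\<dots> = (\<Sum>v\<in>\<theta> ` {..?n}. of_int (w v) * v)"
      using t(2) by (intro sum.mono_neutral_left) (auto simp: w_def)
    also have "\<dots> = (\<Sum>i\<le>?n. of_int (w (\<theta> i)) * \<theta> i)"
      using inj by (simp add: sum.reindex)
    also have "\<dots> = (\<Sum>i<?n. of_int (w (\<tau> (e i))) * \<tau> (e i)) + of_int (w 1)"
      by (simp add: lessThan_Suc_atMost[symmetric] \<theta>_def)
    also have "(\<Sum>i<?n. of_int (w (\<tau> (e i))) * \<tau> (e i)) = (\<Sum>i\<in>UNIV. of_int (w (\<tau> i)) * \<tau> i)"
      using e by (rule sum.reindex_bij_betw)
    finally have sum0: "(\<Sum>i\<in>UNIV. of_int (w (\<tau> i)) * \<tau> i) + of_int (w 1) = 0"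
      by simp
    then have w0: "(\<lambda>i. w (\<tau> i)) = (\<lambda>_. 0)"
      by (rule indep)
    then have "w (\<tau> i) = 0" for i
      by (rule fun_cong)
    then have "w 1 = 0"
      using sum0 by simp
    then have "w (\<theta> i) = 0" for i
      using \<open>\<And>i. w (\<tau> i) = 0\<close> by (simp add: \<theta>_def)
    then have "w v = 0"
      using t(2,4) by blast
    then show "u v = 0"
      using t(4) by (simp add: w_def)
  qed
  then obtain k m where km: "\<And>i. i < ?n \<Longrightarrow>
      \<bar>of_int k * \<theta> i - of_int (m i) - (\<alpha> \<circ> e) i\<bar> < \<epsilon>"
    using Kronecker_thm_2[of \<theta> ?n \<epsilon> "\<alpha> \<circ> e"] inj assms(2) by (auto simp: \<theta>_def)
  have "\<bar>of_int k * \<tau> i - of_int (m (inv_into {..<?n} e i)) - \<alpha> i\<bar> < \<epsilon>" for i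
    using km[of "inv_into {..<?n} e i"] bij_betw_inv_into_right[OF e, of i]
      bij_betwE[OF bij_betw_inv_into[OF e], of ] by (auto simp: \<theta>_def)
  then show ?thesis
    by (rule that[of k "\<lambda>i. m (inv_into {..<?n} e i)"])
qed

section \<open>The projected dual lattice\<close>

text \<open>Row i of the inverse reads off the i-th coordinate of a lattice point, which is an
  integer.\<close>

lemma dual_lattice_row:
  assumes "B ** A = mat 1"
  shows "row i B \<in> dual_lattice (matrix_lattice A)"
proof -
  have "(A *v z) \<bullet> row i B = z $ i" for z
  proof -
    have "(A *v z) \<bullet> row i B = (B *v (A *v z)) $ i"
      by (simp add: matrix_vector_mul_component row_def inner_commute vec_lambda_eta)
    then show ?thesis
      using assms by (simp add: matrix_vector_mul_assoc)
  qed
  then show ?thesis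
    by (auto simp: dual_lattice_def matrix_lattice_def)
qed

lemma p1_add: "p1 (x + y) = p1 x + p1 y"
  by (simp add: p1_def vec_eq_iff)

lemma p1_scaleR: "p1 (c *\<^sub>R x) = c *\<^sub>R p1 x"
  by (simp add: p1_def vec_eq_iff)

lemma p1_dual_lattice_closed:
  assumes "x \<in> p1 ` dual_lattice \<Gamma>"
  shows "y \<in> p1 ` dual_lattice \<Gamma> \<Longrightarrow> x + y \<in> p1 ` dual_lattice \<Gamma>"
    and "of_int n *\<^sub>R x \<in> p1 ` dual_lattice \<Gamma>"
    and "- x \<in> p1 ` dual_lattice \<Gamma>"
proof -
  obtain x' where x': "x' \<in> dual_lattice \<Gamma>" "x = p1 x'"
    using assms by blast
  show n: "of_int n *\<^sub>R x \<in> p1 ` dual_lattice \<Gamma>" for n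
    using x' by (intro image_eqI[of _ _ "of_int n *\<^sub>R x'"]) (auto simp: p1_scaleR dual_lattice_def)
  show "- x \<in> p1 ` dual_lattice \<Gamma>"
    using n[of "- 1"] by simp
  assume "y \<in> p1 ` dual_lattice \<Gamma>"
  then obtain y' where "y' \<in> dual_lattice \<Gamma>" "y = p1 y'"
    by blast
  then show "x + y \<in> p1 ` dual_lattice \<Gamma>"
    using x' by (intro image_eqI[of _ _ "x' + y'"]) (auto simp: p1_add dual_lattice_def inner_add_right)
qed

lemma zero_in_p1_dual_lattice: "0 \<in> p1 ` dual_lattice \<Gamma>"
  by (intro image_eqI[of _ _ 0]) (auto simp: p1_def dual_lattice_def vec_eq_iff)

lemma sum_in_p1_dual_lattice:
  assumes "\<And>i. i \<in> F \<Longrightarrow> x i \<in> p1 ` dual_lattice \<Gamma>"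
  shows "(\<Sum>i\<in>F. x i) \<in> p1 ` dual_lattice \<Gamma>"
  using assms
  by (induction F rule: infinite_finite_induct) (auto simp: zero_in_p1_dual_lattice p1_dual_lattice_closed(1))

text \<open>All three facts express that the linear map sending the unit vectors to the v i is
  bijective.\<close>

lemma independent_of_det_nonzero:
  fixes v :: "'d::finite \<Rightarrow> real ^ 'd"
  assumes "det (\<chi> i. v i) \<noteq> 0"
  shows "inj v" "independent (range v)" "\<exists>\<alpha>. y = (\<Sum>i\<in>UNIV. \<alpha> i *\<^sub>R v i)"
proof -
  let ?f = "\<lambda>t. \<Sum>i\<in>UNIV. t $ i *\<^sub>R v i"
  have "det (matrix ?f) \<noteq> 0"
    unfolding matrix_sum_scaleR_nth det_transpose by (rule assms)
  then have f: "inj ?f"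
    unfolding det_nz_iff_inj[OF linear_sum_scaleR_nth[of v]] .
  have v: "?f (axis i 1) = v i" for i
    by (simp add: axis_def if_distrib[of "\<lambda>x. x *\<^sub>R _"] cong: if_cong)
  show "inj v"
  proof (rule injI)
    fix i j assume "v i = v j"
    then have "?f (axis i 1) = ?f (axis j 1)"
      by (simp only: v)
    then have "axis i 1 = (axis j 1 :: real ^ 'd)"
      by (rule injD[OF f])
    then show "i = j"
      by (simp add: axis_eq_axis)
  qed
  have Basis: "(Basis :: (real ^ 'd) set) = range (\<lambda>i. axis i 1)"
    by (auto simp: Basis_vec_def)
  have im: "?f ` Basis = range v"
    unfolding Basis image_image v by (rule refl)
  have "independent (?f ` Basis)"
    by (rule linear_independent_injective_image[OF linear_sum_scaleR_nth independent_Basis])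
      (rule inj_on_subset[OF f subset_UNIV])
  then show "independent (range v)"
    unfolding im .
  have "surj ?f"
    by (rule linear_injective_imp_surjective[OF linear_sum_scaleR_nth f]) (rule refl)
  from surjD[OF this, of y] obtain t where t: "y = ?f t" ..
  then show "\<exists>\<alpha>. y = (\<Sum>i\<in>UNIV. \<alpha> i *\<^sub>R v i)"
    by (intro exI[of _ "\<lambda>i. t $ i"])
qed

text \<open>The last dual basis vector has coordinates \<open>- A\<^sub>N\<^sub>i / A\<^sub>N\<^sub>N\<close> (\<open>N\<close> is
  \<^const>\<open>None\<close>) with respect to the others after
  projection, and injectivity of \<^const>\<open>p2\<close> makes these numbers and \<open>1\<close> linearly independent over
  the integers.\<close>

lemma closure_p1_dual_lattice:
  fixes A B :: "real ^ ('d::finite option) ^ ('d option)"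
  assumes "A ** B = mat 1" "B ** A = mat 1" "inj_on p2 (matrix_lattice A)"
  shows "closure (p1 ` dual_lattice (matrix_lattice A)) = UNIV"
proof -
  let ?G = "p1 ` dual_lattice (matrix_lattice A)"
  let ?a = "\<lambda>j. A $ None $ j"
  define v where "v = (\<lambda>i. p1 (row (Some i) B))"
  have UNIV_eq: "(\<Sum>i\<in>UNIV. f i) = f None + (\<Sum>i\<in>UNIV. f (Some i))" for f :: "'d option \<Rightarrow> real"
    by (simp add: UNIV_option_conv sum.reindex)
  \<comment> \<open>An integer relation among the entries of row \<open>None\<close> is a lattice
    point with \<open>p2\<close> equal to 0; injectivity makes the point 0, and B then recovers its
    coordinates as 0.\<close>
  have indep: "n = (\<lambda>_. 0)" if "(\<Sum>j\<in>UNIV. of_int (n j) * ?a j) = 0" for n :: "'d option \<Rightarrow> int"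
  proof -
    let ?z = "\<chi> j. real_of_int (n j)"
    have "p2 (A *v ?z) = p2 (A *v 0)"
      using that by (simp add: p2_def matrix_vector_mult_def mult.commute)
    moreover have "A *v ?z \<in> matrix_lattice A" "A *v 0 \<in> matrix_lattice A"
      unfolding matrix_lattice_def by (intro imageI, simp)+
    ultimately have "A *v ?z = A *v 0"
      using assms(3) by (metis inj_onD)
    then have "(B ** A) *v ?z = 0"
      by (simp only: matrix_vector_mul_assoc[symmetric] matrix_vector_mult_0_right)
    then have "?z = 0"
      by (simp only: assms(2) matrix_vector_mul_lid)
    then show ?thesis
      by (simp add: vec_eq_iff fun_eq_iff)
  qed
  have a_nz: "?a None \<noteq> 0"
  proof
    assume "?a None = 0"
    then have "(\<lambda>j :: 'd option. of_bool (j = None) :: int) = (\<lambda>_. 0)"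
      by (intro indep) (simp add: of_bool_def if_distrib[of real_of_int] if_distrib[of "\<lambda>x. x * _"] cong: if_cong)
    from fun_cong[OF this, of None] show False
      by simp
  qed
  have det: "det (\<chi> i. v i) \<noteq> 0"
  proof
    assume "det (\<chi> i. v i) = 0"
    moreover have "(\<chi> i. v i) = (\<chi> i j. B $ Some i $ Some j)"
      by (simp add: vec_eq_iff v_def p1_def row_def)
    ultimately show False
      using det_minor_of_inverse[OF assms(2)] a_nz by simp
  qed
  define \<tau> where "\<tau> = (\<lambda>i. ?a (Some i) / ?a None)"
  have \<tau>_indep: "c = (\<lambda>_. 0)" if "(\<Sum>i\<in>UNIV. of_int (c i) * \<tau> i) + of_int k = 0"
    for c :: "'d \<Rightarrow> int" and k
  proof -
    let ?n = "\<lambda>j. case j of None \<Rightarrow> k | Some i \<Rightarrow> c i"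
    have "(\<Sum>j\<in>UNIV. of_int (?n j) * ?a j) = ?a None * ((\<Sum>i\<in>UNIV. of_int (c i) * \<tau> i) + of_int k)"
      using a_nz by (simp add: UNIV_eq \<tau>_def distrib_left sum_distrib_left)
    then have "?n = (\<lambda>_. 0)"
      using that by (intro indep) simp
    then have "?n (Some i) = 0" for i
      by (rule fun_cong)
    then show ?thesis
      by (simp add: fun_eq_iff)
  qed
  \<comment> \<open>The entries of \<open>A ** B\<close> in row \<open>None\<close> and the columns
    \<open>Some q\<close> are 0; the equation is solved for row \<open>None\<close> of B.\<close>
  have last: "p1 (row None B) = - (\<Sum>i\<in>UNIV. \<tau> i *\<^sub>R v i)"
  proof -
    have "?a None * B $ None $ Some q + (\<Sum>i\<in>UNIV. ?a (Some i) * B $ Some i $ Some q) = 0" for q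
      using arg_cong[OF assms(1), of "\<lambda>M. M $ None $ Some q"]
      by (simp add: matrix_matrix_mult_def UNIV_eq mat_def)
    then have "B $ None $ Some q = - (\<Sum>i\<in>UNIV. ?a (Some i) * B $ Some i $ Some q) / ?a None" for q
      using a_nz by (simp add: nonzero_eq_divide_eq add_eq_0_iff mult.commute)
    then show ?thesis
      by (simp add: vec_eq_iff p1_def row_def v_def \<tau>_def sum_divide_distrib)
  qed
  have "\<exists>g\<in>?G. dist g y < \<epsilon>" if "\<epsilon> > 0" for y \<epsilon>
  proof -
    from independent_of_det_nonzero(3)[OF det, of y]
    obtain \<alpha> where \<alpha>: "y = (\<Sum>i\<in>UNIV. \<alpha> i *\<^sub>R v i)" ..
    \<comment> \<open>The total error is at most \<open>\<eta>\<close> times the sum of the norms;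
      the added 1 keeps the denominator positive and the final bound strict.\<close>
    define \<eta> where "\<eta> = \<epsilon> / (1 + (\<Sum>i\<in>UNIV. norm (v i)))"
    have den: "1 + (\<Sum>i\<in>UNIV. norm (v i)) > 0"
      by (simp add: add_pos_nonneg sum_nonneg)
    then have \<eta>: "\<eta> > 0"
      using that by (simp add: \<eta>_def)
    have "\<exists>k m. \<forall>i. \<bar>of_int k * \<tau> i - of_int (m i) - \<alpha> i\<bar> < \<eta>"
      by (rule Kronecker_finite[where \<tau> = \<tau> and \<alpha> = \<alpha> and \<epsilon> = \<eta>]) (use \<tau>_indep \<eta> in blast)+
    then obtain k m where km: "\<And>i. \<bar>of_int k * \<tau> i - of_int (m i) - \<alpha> i\<bar> < \<eta>"
      by blast
    \<comment> \<open>The factor - k cancels the minus sign in \<open>last\<close>, so g has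
      coordinates k * \<tau> i - m i, the numbers brought close to \<alpha> i.\<close>
    define g where "g = of_int (- k) *\<^sub>R p1 (row None B) + (\<Sum>i\<in>UNIV. of_int (- m i) *\<^sub>R v i)"
    have "g \<in> ?G"
      unfolding g_def v_def
      by (intro p1_dual_lattice_closed(1,2) sum_in_p1_dual_lattice imageI dual_lattice_row assms(2))
    have "of_int (- k) *\<^sub>R p1 (row None B) = (\<Sum>i\<in>UNIV. (of_int k * \<tau> i) *\<^sub>R v i)"
      unfolding last by (simp add: scaleR_sum_right sum_negf)
    moreover have "(\<Sum>i\<in>UNIV. of_int (- m i) *\<^sub>R v i) = - (\<Sum>i\<in>UNIV. of_int (m i) *\<^sub>R v i)"
      by (simp add: sum_negf)
    ultimately have "g - y = (\<Sum>i\<in>UNIV. (of_int k * \<tau> i - of_int (m i) - \<alpha> i) *\<^sub>R v i)"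
      unfolding g_def \<alpha> by (simp add: scaleR_left_diff_distrib sum_subtractf)
    also have "norm \<dots> \<le> (\<Sum>i\<in>UNIV. \<eta> * norm (v i))"
      by (rule sum_norm_le) (simp add: mult_right_mono less_imp_le[OF km])
    also have "\<dots> < \<eta> * (1 + (\<Sum>i\<in>UNIV. norm (v i)))"
      using \<eta> by (simp add: distrib_left sum_distrib_left)
    also have "\<dots> = \<epsilon>"
      using den by (simp add: \<eta>_def)
    finally show ?thesis
      using \<open>g \<in> ?G\<close> by (auto simp: dist_norm)
  qed
  then show ?thesis
    by (auto simp: closure_approachable)
qed

text \<open>Here h is m times \<open>A $ None $ None\<close>, while the projected dual vectors have
  determinant \<open>A $ None $ None\<close> divided by det A; scaling one of them by m gives h /
  det A. The sign of m may be either, and h > 0 excludes degeneracy.\<close>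

lemma parallelepiped_of_dual_lattice:
  fixes A :: "real ^ ('d::finite option) ^ ('d option)"
  assumes "A ** B = mat 1" "B ** A = mat 1"
    and "h = p2 (A *v axis None (of_int m))" "h > 0"
  obtains v :: "'d \<Rightarrow> real ^ 'd" where "\<And>i. v i \<in> p1 ` dual_lattice (matrix_lattice A)"
    "\<bar>det (\<chi> i. v i)\<bar> = h / \<bar>det A\<bar>" "det (\<chi> i. v i) \<noteq> 0"
proof -
  \<comment> \<open>Any single index serves: the factor m must enter the determinant exactly
    once.\<close>
  obtain i0 :: 'd where True by blast
  define w where "w = (\<lambda>i. p1 (row (Some i) B))"
  define v where "v = (\<lambda>i. if i = i0 then of_int m *s w i else w i)"
  have "h = A $ None $ None * of_int m"
    by (simp add: assms(3) p2_def matrix_vector_mult_def axis_def if_distrib[of "\<lambda>x. _ * x"] cong: if_cong)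
  moreover have "det A \<noteq> 0"
    using assms(1) by (metis det_mul det_I mult_zero_left zero_neq_one)
  moreover have "det (\<chi> i. v i) = of_int m * det (\<chi> i. w i)"
    using det_row_mul[of i0 "of_int m" w w] by (simp add: v_def)
  moreover have "det (\<chi> i. w i) * det A = A $ None $ None"
    using det_minor_of_inverse[OF assms(2)] by (simp add: w_def p1_def row_def)
  ultimately have det: "det (\<chi> i. v i) = h / det A"
    by (simp add: field_simps)
  show ?thesis
  proof
    show "v i \<in> p1 ` dual_lattice (matrix_lattice A)" for i
      unfolding v_def w_def scalar_mult_eq_scaleR
      by (auto intro!: p1_dual_lattice_closed(2) imageI dual_lattice_row assms(2))
    show "\<bar>det (\<chi> i. v i)\<bar> = h / \<bar>det A\<bar>" "det (\<chi> i. v i) \<noteq> 0"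
      using det assms(4) \<open>det A \<noteq> 0\<close> by auto
  qed
qed

theorem proposition1p3:
  fixes \<Gamma> :: "(real ^ ('d::finite option)) set"
    and a b D :: real
    and I :: "real set"
    and \<Lambda> K U :: "(real ^ 'd) set"
  assumes "is_lattice \<Gamma>"
    and "general_position \<Gamma>"
    and "a < b"
    and "I = {a..<b} \<or> I = {a<..b}"
    and "b - a \<in> p2 ` \<Gamma>"
    and "\<Lambda> = simple_quasicrystal \<Gamma> I"
    and "D = (b - a) / lattice_det \<Gamma>"
    and "compact K"
    and "open U"
    and "K \<subseteq> U"
    and "emeasure lebesgue K < ennreal D"
    and "ennreal D < emeasure lebesgue U"
  shows "\<exists>S. riemann_measurable S \<and> K \<subseteq> S \<and> S \<subseteq> U \<and>
           emeasure lebesgue S = ennreal D \<and>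
           (\<exists>v. (\<forall>i. v i \<in> p1 ` dual_lattice \<Gamma>) \<and> inj v \<and> independent (range v) \<and>
                equidecomposable (p1 ` dual_lattice \<Gamma>) S (parallelepiped v))"
proof -
  let ?G = "p1 ` dual_lattice \<Gamma>"
  obtain A0 where A0: "invertible A0" "\<Gamma> = matrix_lattice A0"
    using assms(1) by (auto simp: is_lattice_def)
  obtain \<gamma> where \<gamma>: "\<gamma> \<in> matrix_lattice A0" "b - a = p2 \<gamma>"
    using assms(5) A0(2) by blast
  obtain x where x: "\<forall>i. x $ i \<in> \<int>" "\<gamma> = A0 *v x"
    using \<gamma>(1) by (auto simp: matrix_lattice_def)
  define z where "z = (\<lambda>i. \<lfloor>x $ i\<rfloor>)"
  have "x = (\<chi> i. of_int (z i))"
    using x(1) by (simp add: z_def vec_eq_iff)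
  then obtain A m where A: "invertible A" "matrix_lattice A = \<Gamma>" "\<gamma> = A *v axis None (of_int m)"
    using matrix_lattice_basis_multiple[OF A0(1), of z None] A0(2) x(2) by auto
  obtain B where B: "A ** B = mat 1" "B ** A = mat 1"
    using A(1) by (auto simp: invertible_def)
  have "b - a = p2 (A *v axis None (of_int m))" "b - a > 0"
    using \<gamma>(2) A(3) assms(3) by simp_all
  from parallelepiped_of_dual_lattice[OF B this]
  obtain v :: "'d \<Rightarrow> real ^ 'd" where v: "\<And>i. v i \<in> ?G"
    "\<bar>det (\<chi> i. v i)\<bar> = (b - a) / \<bar>det A\<bar>" "det (\<chi> i. v i) \<noteq> 0"
    unfolding A(2) by blast
  have "lattice_det \<Gamma> = \<bar>det A\<bar>"
    using lattice_det_matrix_lattice[OF A(1)] A(2) by simp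
  then have Q: "emeasure lebesgue (parallelepiped v) = ennreal D"
    using v(2) assms(7) by (simp only: emeasure_parallelepiped)
  have "inj_on p2 (matrix_lattice A)"
    using assms(2) A(2) by (simp add: general_position_def)
  from closure_p1_dual_lattice[OF B this] have "closure ?G = UNIV"
    unfolding A(2) .
  moreover have "riemann_measurable (parallelepiped v)"
    by (intro riemann_measurable_convex convex_bounded_parallelepiped)
  ultimately obtain S where S: "K \<subseteq> S" "S \<subseteq> U" "exact_equidec ?G S (parallelepiped v)"
    using exact_equidec_between_compact_open[where G = ?G and Q = "parallelepiped v",
        OF _ p1_dual_lattice_closed(3) assms(8-10), unfolded Q, OF _ _ _ assms(11,12)]
    by blast
  \<comment> \<open>All three come from the exact equidecomposition: S is a finite union of Riemann
    measurable pieces, and translation keeps their measure.\<close>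
  have "riemann_measurable S" "emeasure lebesgue S = ennreal D"
    "equidecomposable ?G S (parallelepiped v)"
    using exact_equidec_riemann_measurable(1)[OF S(3)] exact_equidec_emeasure[OF S(3)]
      exact_equidec_imp_equidecomposable[OF S(3)] Q by simp_all
  then show ?thesis
    using S(1,2) v(1) independent_of_det_nonzero(1,2)[OF v(3)] by blast
qed

end
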